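(* Let $\mathbf{d}$ be a distance on a set $X$. The following are equivalent. (1) $X$ is $\mathbf{d}^\bullet_\circ$-continuous. (2) $\mathcal{F}\mathbf{d}\circ\Phi^{\mathbf{d}}\leq\mathcal{F}\mathbf{d}$. (3) $\mathcal{F}\mathbf{d}\circ\mathbf{d}\precapprox\mathcal{F}\mathbf{d}$ and $\mathbf{d}\circ\Phi^{\mathbf{d}}\leq\mathbf{d}$. (4) For every $\underline{\mathbf{d}}$-Cauchy net $(x_\lambda)\subseteq X$ there is a $\mathbf{d}$-Cauchy net $(y_\gamma)\subseteq X$ with $(x_\lambda)\underline{\mathbf{d}}=(y_\gamma)\underline{\mathbf{d}}$ and $\mathbf{d}(x_\lambda)=\mathbf{d}(y_\gamma)$.
   Context: Suprema and infima are taken in $[0,\infty]$, with $\sup\emptyset=0$, $\inf\emptyset=\infty$; for $a,b\in[0,\infty]$, $(a-b)_+=\min\{c\in[0,\infty]:a\leq b+c\}$. A distance on $X$ is a function $\mathbf{d}:X\times X\to[0,\infty]$, written $x\mathbf{d}y$, with $x\mathbf{d}z\leq x\mathbf{d}y+y\mathbf{d}z$ for all $x,y,z$ (no symmetry, and $x\mathbf{d}x=0$ is not required). The lower hemimetric is $z\underline{\mathbf{d}}y=\sup_{x\in X}(x\mathbf{d}y-x\mathbf{d}z)_+$. For functions $\mathbf{a}:W\times Z\to[0,\infty]$, $\mathbf{b}:Z\times Y\to[0,\infty]$: $w(\mathbf{a}\circ\mathbf{b})y=\inf_{z\in Z}(w\mathbf{a}z+z\mathbf{b}y)$ and $w(\mathbf{a}\circ\Phi^{\mathbf{b}})y=\sup_{\epsilon>0}\inf\{w\mathbf{a}z: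 z\in Z,\ z\mathbf{b}y<\epsilon\}$. Functions are ordered pointwise by $\leq$. For $\mathbf{a},\mathbf{b}:W\times Y\to[0,\infty]$, $\mathbf{a}\precapprox\mathbf{b}$ means that for all $Z\subseteq W\times Y$, $\inf_{(w,y)\in Z}w\mathbf{b}y=0$ implies $\inf_{(w,y)\in Z}w\mathbf{a}y=0$. $\mathcal{F}(X)$ is the set of finite subsets of $X$ (including $\emptyset$), and $\mathcal{F}\mathbf{d}:\mathcal{F}(X)\times X\to[0,\infty]$ is $F(\mathcal{F}\mathbf{d})x=\sup_{y\in F}y\mathbf{d}x$. A net is a family $(x_\lambda)_{\lambda\in\Lambda}$ indexed by a non-empty set $\Lambda$ with a transitive (not necessarily reflexive) relation $\prec$ such that any two elements $\gamma,\delta$ have some $\lambda$ with $\gamma,\delta\prec\lambda$. Limits, $\limsup_\lambda r_\lambda=\inf_\gamma\sup_{\gamma\prec\lambda}r_\lambda$, $\liminf$ and convergence are taken along $\prec$ (a net converges to $x$ if for each neighbourhood $N$ of $x$ there is $\gamma$ with $x_\lambda\in N$ whenever $\gamma\prec\lambda$). $(x_\lambda)$ is $\mathbf{d}$-Cauchy if $\lim_\gamma\sup_{\gamma\prec\delta}x_\gamma\mathbf{d}x_\delta=0$ (similarly for $\underline{\mathbf{d}}$). For a net, $(x_\lambda)\mathbf{d}$ is the function $y\mapsto\limsup_\lambda x_\lambda\mathbf{d}y$ and $\mathbf{d}(x_\lambda)$ is the function $y\mapsto\liminf_\lambda y\mathbf{d}x_\lambda$ (similarly for $\underline{\mathbf{d}}$).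 The Smyth topology $\mathbf{d}^\bullet_\circ$ is generated by the sets $\{x\in X:c\mathbf{d}x<r\}$ and $\{x\in X:c\mathbf{d}x>r\}$ ($c\in X$, $r$ real); so $x_\lambda\to x$ in $\mathbf{d}^\bullet_\circ$ iff $c\mathbf{d}x_\lambda\to c\mathbf{d}x$ in $[0,\infty]$ for all $c\in X$. $X$ is $\mathbf{d}^\bullet_\circ$-continuous if every $x\in X$ is a $\mathbf{d}^\bullet_\circ$-limit of some $\mathbf{d}$-Cauchy net in $X$. *)

theory Defs
  imports "HOL-Analysis.Analysis"
begin

definition distance_on :: "'a set \<Rightarrow> ('a \<Rightarrow> 'a \<Rightarrow> ennreal) \<Rightarrow> bool" where
  "distance_on X d \<longleftrightarrow> (\<forall>x\<in>X. \<forall>y\<in>X. \<forall>z\<in>X. d x z \<le> d x y + d y z)"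

text \<open>The positive part \<open>(a - b)\<^sub>+\<close>. It is not the subtraction on \<^typ>\<open>ennreal\<close>, for which
  \<open>\<infinity> - \<infinity> = \<infinity>\<close>, whereas here \<open>(\<infinity> - \<infinity>)\<^sub>+ = 0\<close>.\<close>

definition pos_diff :: "ennreal \<Rightarrow> ennreal \<Rightarrow> ennreal" where
  "pos_diff a b = (LEAST c. a \<le> b + c)"

lemma pos_diff_eq: "pos_diff a b = (if b = \<infinity> then 0 else a - b)"
proof (cases "b = \<infinity>")
  case True
  then show ?thesis
    unfolding pos_diff_def by (auto intro!: Least_equality)
next
  case False
  have "(LEAST c. a \<le> b + c) = a - b"
  proof (rule Least_equality)
    show "a \<le> b + (a - b)"
    proof (cases "a \<le> b")
      case True
      then show ?thesis
        by (rule add_increasing2[rotated]) simp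
    next
      case False
      then have "a - b + b = a"
        by (intro diff_add_cancel_ennreal) simp
      then have "b + (a - b) = a"
        by (subst add.commute)
      then show ?thesis
        by (rule eq_refl[OF sym])
    qed
    show "a - b \<le> c" if "a \<le> b + c" for c
      using False that by (auto simp: ennreal_minus_le_iff)
  qed
  with False show ?thesis
    by (simp add: pos_diff_def)
qed

definition lower_hemimetric :: "'a set \<Rightarrow> ('a \<Rightarrow> 'a \<Rightarrow> ennreal) \<Rightarrow> 'a \<Rightarrow> 'a \<Rightarrow> ennreal" where
  "lower_hemimetric X d z y = (SUP x\<in>X. pos_diff (d x y) (d x z))"

text \<open>\<open>a \<circ> b\<close> and \<open>a \<circ> \<Phi>\<^sup>b\<close>, with \<open>Z\<close> the common middle set.\<close>

definition rel_comp ::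
  "'z set \<Rightarrow> ('w \<Rightarrow> 'z \<Rightarrow> ennreal) \<Rightarrow> ('z \<Rightarrow> 'y \<Rightarrow> ennreal) \<Rightarrow> 'w \<Rightarrow> 'y \<Rightarrow> ennreal" where
  "rel_comp Z a b w y = (INF z\<in>Z. a w z + b z y)"

definition rel_comp_Phi ::
  "'z set \<Rightarrow> ('w \<Rightarrow> 'z \<Rightarrow> ennreal) \<Rightarrow> ('z \<Rightarrow> 'y \<Rightarrow> ennreal) \<Rightarrow> 'w \<Rightarrow> 'y \<Rightarrow> ennreal" where
  "rel_comp_Phi Z a b w y = (SUP \<epsilon>\<in>{0::real<..}. INF z\<in>{z\<in>Z. b z y < ennreal \<epsilon>}. a w z)"

definition rel_le ::
  "'w set \<Rightarrow> 'y set \<Rightarrow> ('w \<Rightarrow> 'y \<Rightarrow> ennreal) \<Rightarrow> ('w \<Rightarrow> 'y \<Rightarrow> ennreal) \<Rightarrow> bool" where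
  "rel_le W Y a b \<longleftrightarrow> (\<forall>w\<in>W. \<forall>y\<in>Y. a w y \<le> b w y)"

definition rel_precapprox ::
  "'w set \<Rightarrow> 'y set \<Rightarrow> ('w \<Rightarrow> 'y \<Rightarrow> ennreal) \<Rightarrow> ('w \<Rightarrow> 'y \<Rightarrow> ennreal) \<Rightarrow> bool" where
  "rel_precapprox W Y a b \<longleftrightarrow>
     (\<forall>Z\<subseteq>W \<times> Y. (INF (w, y)\<in>Z. b w y) = 0 \<longrightarrow> (INF (w, y)\<in>Z. a w y) = 0)"

definition fin_dist :: "('a \<Rightarrow> 'a \<Rightarrow> ennreal) \<Rightarrow> 'a set \<Rightarrow> 'a \<Rightarrow> ennreal" where
  "fin_dist d F x = (SUP y\<in>F. d y x)"

definition directed_index :: "'i set \<Rightarrow> ('i \<Rightarrow> 'i \<Rightarrow> bool) \<Rightarrow> bool" where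
  "directed_index I R \<longleftrightarrow> I \<noteq> {} \<and> transp_on I R \<and>
     (\<forall>\<gamma>\<in>I. \<forall>\<delta>\<in>I. \<exists>\<mu>\<in>I. R \<gamma> \<mu> \<and> R \<delta> \<mu>)"

definition net_in :: "'a set \<Rightarrow> 'i set \<Rightarrow> ('i \<Rightarrow> 'i \<Rightarrow> bool) \<Rightarrow> ('i \<Rightarrow> 'a) \<Rightarrow> bool" where
  "net_in X I R x \<longleftrightarrow> directed_index I R \<and> x ` I \<subseteq> X"

text \<open>Limits along a net are limits along its filter of tails; the lemmas below relate the
  library's notions for that filter to the usual formulas for nets.\<close>

definition net_filter :: "'i set \<Rightarrow> ('i \<Rightarrow> 'i \<Rightarrow> bool) \<Rightarrow> 'i filter" where
  "net_filter I R = (INF \<gamma>\<in>I. principal {\<mu>\<in>I. R \<gamma> \<mu>})"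

lemma eventually_net_filter:
  assumes "directed_index I R"
  shows "eventually P (net_filter I R) \<longleftrightarrow> (\<exists>\<gamma>\<in>I. \<forall>\<mu>\<in>I. R \<gamma> \<mu> \<longrightarrow> P \<mu>)"
proof -
  have ne: "I \<noteq> {}"
    using assms by (simp add: directed_index_def)
  have "\<exists>c\<in>I. principal {\<mu>\<in>I. R c \<mu>} \<le> inf (principal {\<mu>\<in>I. R a \<mu>}) (principal {\<mu>\<in>I. R b \<mu>})"
    if ab: "a \<in> I" "b \<in> I" for a b
  proof -
    obtain c where c: "c \<in> I" "R a c" "R b c"
      using assms ab unfolding directed_index_def by blast
    have "{\<mu>\<in>I. R c \<mu>} \<subseteq> {\<mu>\<in>I. R a \<mu>} \<inter> {\<mu>\<in>I. R b \<mu>}"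
      using assms ab c unfolding directed_index_def transp_on_def by blast
    then show ?thesis
      using c(1) by auto
  qed
  then have "eventually P (net_filter I R) \<longleftrightarrow> (\<exists>\<gamma>\<in>I. eventually P (principal {\<mu>\<in>I. R \<gamma> \<mu>}))"
    unfolding net_filter_def using ne by (intro eventually_INF_base) auto
  then show ?thesis
    unfolding eventually_principal by blast
qed

lemma Limsup_net_filter:
  fixes r :: "'i \<Rightarrow> ennreal"
  assumes "directed_index I R"
  shows "Limsup (net_filter I R) r = (INF \<gamma>\<in>I. SUP \<mu>\<in>{\<mu>\<in>I. R \<gamma> \<mu>}. r \<mu>)"
proof (rule antisym)
  show "Limsup (net_filter I R) r \<le> (INF \<gamma>\<in>I. SUP \<mu>\<in>{\<mu>\<in>I. R \<gamma> \<mu>}. r \<mu>)"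
  proof (rule INF_greatest)
    fix \<gamma> assume "\<gamma> \<in> I"
    then have "eventually (\<lambda>\<mu>. \<mu> \<in> {\<mu>\<in>I. R \<gamma> \<mu>}) (net_filter I R)"
      using eventually_net_filter[OF assms] by auto
    then show "Limsup (net_filter I R) r \<le> (SUP \<mu>\<in>{\<mu>\<in>I. R \<gamma> \<mu>}. r \<mu>)"
      unfolding Limsup_def by (intro INF_lower2[of "\<lambda>\<mu>. \<mu> \<in> {\<mu>\<in>I. R \<gamma> \<mu>}"]) auto
  qed
  show "(INF \<gamma>\<in>I. SUP \<mu>\<in>{\<mu>\<in>I. R \<gamma> \<mu>}. r \<mu>) \<le> Limsup (net_filter I R) r"
    unfolding Limsup_def
  proof (rule INF_greatest)
    fix P assume "P \<in> {P. eventually P (net_filter I R)}"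
    then obtain \<gamma> where \<gamma>: "\<gamma> \<in> I" "\<forall>\<mu>\<in>I. R \<gamma> \<mu> \<longrightarrow> P \<mu>"
      using eventually_net_filter[OF assms] by auto
    show "(INF \<gamma>\<in>I. SUP \<mu>\<in>{\<mu>\<in>I. R \<gamma> \<mu>}. r \<mu>) \<le> (SUP x\<in>{x. P x}. r x)"
      using \<gamma> by (intro INF_lower2[of \<gamma>] SUP_subset_mono) auto
  qed
qed

lemma Liminf_net_filter:
  fixes r :: "'i \<Rightarrow> ennreal"
  assumes "directed_index I R"
  shows "Liminf (net_filter I R) r = (SUP \<gamma>\<in>I. INF \<mu>\<in>{\<mu>\<in>I. R \<gamma> \<mu>}. r \<mu>)"
proof (rule antisym)
  show "(SUP \<gamma>\<in>I. INF \<mu>\<in>{\<mu>\<in>I. R \<gamma> \<mu>}. r \<mu>) \<le> Liminf (net_filter I R) r"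
  proof (rule SUP_least)
    fix \<gamma> assume "\<gamma> \<in> I"
    then have "eventually (\<lambda>\<mu>. \<mu> \<in> {\<mu>\<in>I. R \<gamma> \<mu>}) (net_filter I R)"
      using eventually_net_filter[OF assms] by auto
    then show "(INF \<mu>\<in>{\<mu>\<in>I. R \<gamma> \<mu>}. r \<mu>) \<le> Liminf (net_filter I R) r"
      unfolding Liminf_def by (intro SUP_upper2[of "\<lambda>\<mu>. \<mu> \<in> {\<mu>\<in>I. R \<gamma> \<mu>}"]) auto
  qed
  show "Liminf (net_filter I R) r \<le> (SUP \<gamma>\<in>I. INF \<mu>\<in>{\<mu>\<in>I. R \<gamma> \<mu>}. r \<mu>)"
    unfolding Liminf_def
  proof (rule SUP_least)
    fix P assume "P \<in> {P. eventually P (net_filter I R)}"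
    then obtain \<gamma> where \<gamma>: "\<gamma> \<in> I" "\<forall>\<mu>\<in>I. R \<gamma> \<mu> \<longrightarrow> P \<mu>"
      using eventually_net_filter[OF assms] by auto
    show "(INF x\<in>{x. P x}. r x) \<le> (SUP \<gamma>\<in>I. INF \<mu>\<in>{\<mu>\<in>I. R \<gamma> \<mu>}. r \<mu>)"
      using \<gamma> by (intro SUP_upper2[of \<gamma>] INF_superset_mono) auto
  qed
qed

definition cauchy_net ::
  "('a \<Rightarrow> 'a \<Rightarrow> ennreal) \<Rightarrow> 'i set \<Rightarrow> ('i \<Rightarrow> 'i \<Rightarrow> bool) \<Rightarrow> ('i \<Rightarrow> 'a) \<Rightarrow> bool" where
  "cauchy_net d I R x \<longleftrightarrow>
     ((\<lambda>\<gamma>. SUP \<delta>\<in>{\<delta>\<in>I. R \<gamma> \<delta>}. d (x \<gamma>) (x \<delta>)) \<longlongrightarrow> 0) (net_filter I R)"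

definition net_dist ::
  "('a \<Rightarrow> 'a \<Rightarrow> ennreal) \<Rightarrow> 'i set \<Rightarrow> ('i \<Rightarrow> 'i \<Rightarrow> bool) \<Rightarrow> ('i \<Rightarrow> 'a) \<Rightarrow> 'a \<Rightarrow> ennreal" where
  "net_dist d I R x y = Limsup (net_filter I R) (\<lambda>\<mu>. d (x \<mu>) y)"

definition dist_net ::
  "('a \<Rightarrow> 'a \<Rightarrow> ennreal) \<Rightarrow> 'i set \<Rightarrow> ('i \<Rightarrow> 'i \<Rightarrow> bool) \<Rightarrow> ('i \<Rightarrow> 'a) \<Rightarrow> 'a \<Rightarrow> ennreal" where
  "dist_net d I R x y = Liminf (net_filter I R) (\<lambda>\<mu>. d y (x \<mu>))"

text \<open>Negative \<open>r\<close> would contribute only \<open>{}\<close> and \<open>X\<close>, while \<^const>\<open>ennreal\<close> truncates them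
  to \<open>0\<close>; the generated topology is the same, and its underlying set is \<open>X\<close>, as the lemma
  below records.\<close>

definition smyth_topology :: "'a set \<Rightarrow> ('a \<Rightarrow> 'a \<Rightarrow> ennreal) \<Rightarrow> 'a topology" where
  "smyth_topology X d = topology_generated_by
     ({{x\<in>X. d c x < ennreal r} |c r. c \<in> X} \<union> {{x\<in>X. d c x > ennreal r} |c r. c \<in> X})"

lemma topspace_smyth_topology: "topspace (smyth_topology X d) = X"
proof
  show "X \<subseteq> topspace (smyth_topology X d)"
  proof
    fix x assume x: "x \<in> X"
    have "d x x < ennreal 1 \<or> d x x > ennreal 0"
      by (cases "d x x = 0") (auto simp: zero_less_iff_neq_zero)
    then show "x \<in> topspace (smyth_topology X d)"
      unfolding smyth_topology_def topology_generated_by_topspace using x by blast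
  qed
qed (auto simp: smyth_topology_def topology_generated_by_topspace)

text \<open>HOL does not quantify over types inside a formula, so an existential over nets has to name
  the type \<open>'i\<close> that contains the index sets; the type argument makes it explicit. As soon as
  \<open>'i\<close> is at least as large as \<open>X \<times> Pow X \<times> \<nat>\<close>, its choice is immaterial: only the filter of
  tails on \<open>X\<close> matters, and this many indices suffice to realise any such filter by a net with
  the same Cauchy property.\<close>

definition smyth_continuous :: "'i itself \<Rightarrow> 'a set \<Rightarrow> ('a \<Rightarrow> 'a \<Rightarrow> ennreal) \<Rightarrow> bool" where
  "smyth_continuous (T :: 'i itself) X d \<longleftrightarrow>
     (\<forall>x\<in>X. \<exists>(I :: 'i set) R x'. net_in X I R x' \<and> cauchy_net d I R x' \<and>
        limitin (smyth_topology X d) x' x (net_filter I R))"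

end

theory Submission
  imports Defs
begin

text \<open>All four conditions are compared with one elementary property, called \<open>approximable\<close> below:
  for every finite \<open>F\<close>, every \<open>x\<close> and every \<open>e > 0\<close> there is a \<open>z\<close> with \<open>d z x < e\<close> and
  \<open>d c z \<le> d c x + e\<close> for each \<open>c \<in> F\<close> separately.

  The condition on \<open>\<F>d \<circ> \<Phi>\<^sup>d\<close> bounds only the supremum over \<open>F\<close>, which says nothing about the
  smaller distances. Its first consequence is the pair of conditions with \<open>\<precapprox>\<close>: singletons give
  \<open>d \<circ> \<Phi>\<^sup>d \<le> d\<close>. This pair recovers the individual bounds
  (\<open>precapprox_imp_approximable\<close>): approximate each \<open>c\<close> by its own point \<open>g c\<close> close to \<open>x\<close>, and
  then find one \<open>z\<close> that is close to \<open>x\<close> and to which all of the finitely many \<open>g c\<close> are close.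

  The conditions on nets rest on one construction, \<open>ex_cauchy_net_with_profile\<close>. Let \<open>f c\<close> be
  the distance from \<open>c\<close> to an ideal point: either \<open>f c = d c x\<close> for a point \<open>x\<close>, or \<open>f c\<close> is
  the limit of \<open>d c (x \<lambda>)\<close> along a Cauchy net for the lower hemimetric. If the ideal point can be
  approximated on finite sets as above, then the approximating points form a \<open>d\<close>-Cauchy net
  whose distances converge to \<open>f\<close>. For a point this is convergence in the Smyth topology; for a
  net it is the replacement required, because the limit profile also determines the distances
  from a net in the lower hemimetric (\<open>lower_cauchy_net_dist_eq\<close>).

  Conversely, the terms of a \<open>d\<close>-Cauchy net converging to \<open>x\<close> are eventually at small distance
  to \<open>x\<close>, so they approximate \<open>x\<close>; and the replacement property yields such a net when it is
  applied to the constant net at \<open>x\<close>.\<close>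

section \<open>Distances and nets\<close>

lemma pos_diff_le_iff: "pos_diff a b \<le> c \<longleftrightarrow> a \<le> b + c"
  by (auto simp: pos_diff_eq ennreal_minus_le_iff)

lemma lower_hemimetric_le_iff:
  "lower_hemimetric X d z y \<le> r \<longleftrightarrow> (\<forall>c\<in>X. d c y \<le> d c z + r)"
  by (simp add: lower_hemimetric_def SUP_le_iff pos_diff_le_iff)

lemma lower_hemimetric_le:
  assumes "distance_on X d" "x \<in> X" "y \<in> X"
  shows "lower_hemimetric X d x y \<le> d x y"
  using assms by (auto simp: lower_hemimetric_le_iff distance_on_def)

lemma ennreal_half: "0 < e \<Longrightarrow> ennreal (e / 2) + ennreal (e / 2) = ennreal e"
  by (simp flip: ennreal_plus)

lemma ennreal_pos_real_below:
  assumes "0 < (a :: ennreal)"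
  obtains e :: real where "0 < e" "ennreal e < a"
proof -
  obtain q where q: "0 < q" "q < a"
    using dense[OF assms] by blast
  then have "0 < enn2real q" "ennreal (enn2real q) = q"
    by (auto simp: enn2real_positive_iff less_top[symmetric] intro!: ennreal_enn2real)
  then show thesis
    using q that by metis
qed

lemma net_filter_neq_bot:
  assumes "directed_index I R"
  shows "net_filter I R \<noteq> bot"
  using assms
  by (auto simp: trivial_limit_def eventually_net_filter) (auto simp: directed_index_def)

lemma eventually_net_filter_after:
  assumes "directed_index I R" "\<gamma> \<in> I"
  shows "\<forall>\<^sub>F \<delta> in net_filter I R. \<delta> \<in> I \<and> R \<gamma> \<delta>"
  using assms by (auto simp: eventually_net_filter)

lemma cauchy_net_iff:
  "cauchy_net d I R x \<longleftrightarrow>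
     (\<forall>e>0. \<forall>\<^sub>F \<gamma> in net_filter I R. \<forall>\<delta>\<in>I. R \<gamma> \<delta> \<longrightarrow> d (x \<gamma>) (x \<delta>) \<le> ennreal e)"
  (is "_ \<longleftrightarrow> ?C")
proof
  assume *: "cauchy_net d I R x"
  show ?C
  proof (intro allI impI)
    fix e :: real assume "0 < e"
    then have "\<forall>\<^sub>F \<gamma> in net_filter I R. (SUP \<delta>\<in>{\<delta>\<in>I. R \<gamma> \<delta>}. d (x \<gamma>) (x \<delta>)) < ennreal e"
      using * unfolding cauchy_net_def by (intro order_tendstoD(2)) auto
    then show "\<forall>\<^sub>F \<gamma> in net_filter I R. \<forall>\<delta>\<in>I. R \<gamma> \<delta> \<longrightarrow> d (x \<gamma>) (x \<delta>) \<le> ennreal e"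
    proof eventually_elim
      case (elim \<gamma>)
      then show ?case
        using less_imp_le[OF elim] by (auto simp: SUP_le_iff)
    qed
  qed
next
  assume C: ?C
  show "cauchy_net d I R x"
    unfolding cauchy_net_def
  proof (rule order_tendstoI)
    fix a :: ennreal assume "0 < a"
    then obtain e where e: "0 < e" "ennreal e < a"
      by (rule ennreal_pos_real_below)
    show "\<forall>\<^sub>F \<gamma> in net_filter I R. (SUP \<delta>\<in>{\<delta>\<in>I. R \<gamma> \<delta>}. d (x \<gamma>) (x \<delta>)) < a"
      using C[rule_format, OF e(1)]
    proof eventually_elim
      case (elim \<gamma>)
      then have "(SUP \<delta>\<in>{\<delta>\<in>I. R \<gamma> \<delta>}. d (x \<gamma>) (x \<delta>)) \<le> ennreal e"
        by (auto simp: SUP_le_iff)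
      then show ?case
        using e(2) by (rule order.strict_trans1)
    qed
  qed auto
qed

text \<open>The two indices are decoupled here: nested \<open>eventually\<close> no longer mentions the index relation,
  so that limits in the inner index can be taken by filter reasoning.\<close>

lemma cauchy_net_eventually:
  assumes dir: "directed_index I R" and "cauchy_net d I R x" "0 < e"
  shows "\<forall>\<^sub>F \<gamma> in net_filter I R. \<forall>\<^sub>F \<delta> in net_filter I R. d (x \<gamma>) (x \<delta>) \<le> ennreal e"
proof -
  have "\<forall>\<^sub>F \<gamma> in net_filter I R. \<gamma> \<in> I"
    using dir by (auto simp: eventually_net_filter directed_index_def)
  moreover have "\<forall>\<^sub>F \<gamma> in net_filter I R. \<forall>\<delta>\<in>I. R \<gamma> \<delta> \<longrightarrow> d (x \<gamma>) (x \<delta>) \<le> ennreal e"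
    using assms by (simp add: cauchy_net_iff)
  ultimately show ?thesis
  proof eventually_elim
    case (elim \<gamma>)
    then show ?case
      using eventually_net_filter_after[OF dir elim(1)] by (auto elim: eventually_mono)
  qed
qed

lemma eventually_net_in:
  assumes "net_in X I R x"
  shows "\<forall>\<^sub>F \<gamma> in net_filter I R. x \<gamma> \<in> X"
  using assms by (auto simp: net_in_def eventually_net_filter directed_index_def image_subset_iff)

lemma cauchy_net_lower_hemimetric:
  assumes dist: "distance_on X d" and net: "net_in X I R x" and "cauchy_net d I R x"
  shows "cauchy_net (lower_hemimetric X d) I R x"
  unfolding cauchy_net_iff
proof (intro allI impI)
  fix e :: real assume "0 < e"
  with assms have "\<forall>\<^sub>F \<gamma> in net_filter I R. \<forall>\<delta>\<in>I. R \<gamma> \<delta> \<longrightarrow> d (x \<gamma>) (x \<delta>) \<le> ennreal e"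
    by (simp add: cauchy_net_iff)
  with eventually_net_in[OF net]
  show "\<forall>\<^sub>F \<gamma> in net_filter I R. \<forall>\<delta>\<in>I. R \<gamma> \<delta> \<longrightarrow>
          lower_hemimetric X d (x \<gamma>) (x \<delta>) \<le> ennreal e"
  proof eventually_elim
    case (elim \<gamma>)
    show ?case
    proof (intro ballI impI)
      fix \<delta> assume \<delta>: "\<delta> \<in> I" "R \<gamma> \<delta>"
      then have "x \<delta> \<in> X"
        using net by (auto simp: net_in_def)
      then show "lower_hemimetric X d (x \<gamma>) (x \<delta>) \<le> ennreal e"
        using lower_hemimetric_le[OF dist elim(1)] elim(2) \<delta> by (blast intro: order.trans)
    qed
  qed
qed

section \<open>Limits along Cauchy nets for the lower hemimetric\<close>

text \<open>Along a Cauchy net for the lower hemimetric, a late value \<open>d c (x \<delta>)\<close> exceeds an earlier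
  value \<open>d c (x \<gamma>)\<close> by at most \<open>e\<close>. This one-sided estimate bounds the limit superior by the limit
  inferior, so \<open>dist_net\<close> is a genuine limit.\<close>

lemma lower_cauchy_tendsto_dist_net:
  assumes dir: "directed_index I R" and C: "cauchy_net (lower_hemimetric X d) I R x"
    and c: "c \<in> X"
  shows "((\<lambda>\<mu>. d c (x \<mu>)) \<longlongrightarrow> dist_net d I R x c) (net_filter I R)"
proof -
  let ?F = "net_filter I R"
  have bot: "?F \<noteq> bot"
    using dir by (rule net_filter_neq_bot)
  have "Limsup ?F (\<lambda>\<mu>. d c (x \<mu>)) \<le> Liminf ?F (\<lambda>\<mu>. d c (x \<mu>))" (is "?S \<le> ?L")
  proof (rule ennreal_le_epsilon)
    fix e :: real assume "0 < e"
    have "\<forall>\<^sub>F \<gamma> in ?F. ?S - ennreal e \<le> d c (x \<gamma>)"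
      using cauchy_net_eventually[OF dir C \<open>0 < e\<close>]
    proof eventually_elim
      case (elim \<gamma>)
      then have "\<forall>\<^sub>F \<delta> in ?F. d c (x \<delta>) \<le> d c (x \<gamma>) + ennreal e"
        by eventually_elim (use c in \<open>auto simp: lower_hemimetric_le_iff\<close>)
      then have "?S \<le> d c (x \<gamma>) + ennreal e"
        by (rule Limsup_bounded)
      then show ?case
        by (simp add: ennreal_minus_le_iff add.commute)
    qed
    then have "?S - ennreal e \<le> ?L"
      by (rule Liminf_bounded)
    then show "?S \<le> ?L + ennreal e"
      by (simp add: ennreal_minus_le_iff add.commute)
  qed
  then show ?thesis
    unfolding dist_net_def using Liminf_le_Limsup[OF bot, of "\<lambda>\<mu>. d c (x \<mu>)"]
    by (intro Liminf_eq_Limsup[OF bot]) auto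
qed

text \<open>The estimate is uniform in \<open>c\<close>, in contrast to the convergence of \<open>d c (x \<mu>)\<close>: one index \<open>\<gamma>\<close>
  serves all of \<open>X\<close>.\<close>

lemma lower_cauchy_dist_net_le:
  assumes dir: "directed_index I R" and C: "cauchy_net (lower_hemimetric X d) I R x" and "0 < e"
  shows "\<forall>\<^sub>F \<gamma> in net_filter I R. \<forall>c\<in>X. dist_net d I R x c \<le> d c (x \<gamma>) + ennreal e"
  using cauchy_net_eventually[OF dir C \<open>0 < e\<close>]
proof eventually_elim
  case (elim \<gamma>)
  show ?case
  proof
    fix c assume c: "c \<in> X"
    have "\<forall>\<^sub>F \<delta> in net_filter I R. d c (x \<delta>) \<le> d c (x \<gamma>) + ennreal e"
      using elim by eventually_elim (use c in \<open>auto simp: lower_hemimetric_le_iff\<close>)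
    then show "dist_net d I R x c \<le> d c (x \<gamma>) + ennreal e"
      using lower_cauchy_tendsto_dist_net[OF dir C c] net_filter_neq_bot[OF dir]
      by (intro tendsto_upperbound)
  qed
qed

text \<open>A supremum over \<open>c\<close> does not commute with limits in general; the bound
  \<open>lower_cauchy_dist_net_le\<close> is uniform in \<open>c\<close>,
  which is what makes \<open>\<le>\<close> work. As a result two Cauchy nets for the lower hemimetric with the same
  \<open>dist_net\<close> also have the same \<open>net_dist\<close>.\<close>

lemma lower_cauchy_net_dist_eq:
  assumes dir: "directed_index I R" and C: "cauchy_net (lower_hemimetric X d) I R x"
  shows "net_dist (lower_hemimetric X d) I R x z =
           (SUP c\<in>X. pos_diff (d c z) (dist_net d I R x c))" (is "?N = ?S")
proof (rule antisym)
  let ?F = "net_filter I R"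
  show "?N \<le> ?S"
  proof (rule ennreal_le_epsilon)
    fix e :: real assume "0 < e"
    have "\<forall>\<^sub>F \<gamma> in ?F. lower_hemimetric X d (x \<gamma>) z \<le> ?S + ennreal e"
      using lower_cauchy_dist_net_le[OF dir C \<open>0 < e\<close>]
    proof eventually_elim
      case (elim \<gamma>)
      show ?case
        unfolding lower_hemimetric_le_iff
      proof
        fix c assume c: "c \<in> X"
        have "pos_diff (d c z) (dist_net d I R x c) \<le> ?S"
          using c by (rule SUP_upper)
        then have "d c z \<le> dist_net d I R x c + ?S"
          by (simp add: pos_diff_le_iff)
        also have "\<dots> \<le> (d c (x \<gamma>) + ennreal e) + ?S"
          using elim c by (intro add_right_mono) auto
        finally show "d c z \<le> d c (x \<gamma>) + (?S + ennreal e)"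
          by (simp add: ac_simps)
      qed
    qed
    then show "?N \<le> ?S + ennreal e"
      unfolding net_dist_def by (rule Limsup_bounded)
  qed
  show "?S \<le> ?N"
  proof (rule SUP_least)
    fix c assume c: "c \<in> X"
    have "d c z \<le> dist_net d I R x c + ?N"
    proof (rule ennreal_le_epsilon)
      (* Finiteness of the bound provides the strict inequality below, which turns the limit
         superior into an eventual bound. *)
      fix e :: real assume e: "0 < e" and top: "dist_net d I R x c + ?N < top"
      then have N: "?N < ?N + ennreal e"
        by (auto simp: ennreal_add_eq_top less_top)
      have "\<forall>\<^sub>F \<gamma> in ?F. lower_hemimetric X d (x \<gamma>) z < ?N + ennreal e"
        using N unfolding net_dist_def by (rule Limsup_lessD)
      then have "\<forall>\<^sub>F \<gamma> in ?F. d c z \<le> d c (x \<gamma>) + (?N + ennreal e)"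
        by eventually_elim (use c in \<open>auto dest!: less_imp_le simp: lower_hemimetric_le_iff\<close>)
      moreover have "((\<lambda>\<gamma>. d c (x \<gamma>) + (?N + ennreal e)) \<longlongrightarrow>
          dist_net d I R x c + (?N + ennreal e)) ?F"
        using lower_cauchy_tendsto_dist_net[OF dir C c] by (intro tendsto_add tendsto_const)
      ultimately have "d c z \<le> dist_net d I R x c + (?N + ennreal e)"
        using net_filter_neq_bot[OF dir] by (intro tendsto_lowerbound)
      then show "d c z \<le> dist_net d I R x c + ?N + ennreal e"
        by (simp add: ac_simps)
    qed
    then show "pos_diff (d c z) (dist_net d I R x c) \<le> ?N"
      by (simp add: pos_diff_le_iff)
  qed
qed

section \<open>Convergence in the Smyth topology\<close>

lemma limitin_smyth_topology_iff:
  assumes ev: "\<forall>\<^sub>F i in F. x' i \<in> X"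
  shows "limitin (smyth_topology X d) x' x F \<longleftrightarrow>
           x \<in> X \<and> (\<forall>c\<in>X. ((\<lambda>i. d c (x' i)) \<longlongrightarrow> d c x) F)"
proof
  let ?B = "{{x\<in>X. d c x < ennreal r} |c r. c \<in> X} \<union> {{x\<in>X. d c x > ennreal r} |c r. c \<in> X}"
  assume lim: "limitin (smyth_topology X d) x' x F"
  then have x: "x \<in> X"
    by (simp add: limitin_def topspace_smyth_topology)
  have ev_basic: "\<forall>\<^sub>F i in F. x' i \<in> U" if "U \<in> ?B" "x \<in> U" for U
    using lim that unfolding limitin_def smyth_topology_def
    by (meson topology_generated_by_Basis)
  have "((\<lambda>i. d c (x' i)) \<longlongrightarrow> d c x) F" if c: "c \<in> X" for c
  proof (rule order_tendstoI)
    fix a assume "a < d c x"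
    then obtain q where q: "a < q" "q < d c x"
      using dense by blast
    then have r: "ennreal (enn2real q) = q"
      by (intro ennreal_enn2real) (metis order.strict_trans2 top_greatest)
    have "\<forall>\<^sub>F i in F. x' i \<in> {y\<in>X. d c y > ennreal (enn2real q)}"
    proof (rule ev_basic)
      show "{y\<in>X. d c y > ennreal (enn2real q)} \<in> ?B"
        using c by blast
    qed (use x q r in auto)
    then show "\<forall>\<^sub>F i in F. a < d c (x' i)"
      by eventually_elim (use q r in auto)
  next
    fix a assume "d c x < a"
    then obtain q where q: "d c x < q" "q < a"
      using dense by blast
    then have r: "ennreal (enn2real q) = q"
      by (intro ennreal_enn2real) (metis order.strict_trans2 top_greatest)
    have "\<forall>\<^sub>F i in F. x' i \<in> {y\<in>X. d c y < ennreal (enn2real q)}"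
    proof (rule ev_basic)
      show "{y\<in>X. d c y < ennreal (enn2real q)} \<in> ?B"
        using c by blast
    qed (use x q r in auto)
    then show "\<forall>\<^sub>F i in F. d c (x' i) < a"
      by eventually_elim (use q r in auto)
  qed
  with x show "x \<in> X \<and> (\<forall>c\<in>X. ((\<lambda>i. d c (x' i)) \<longlongrightarrow> d c x) F)"
    by blast
next
  let ?B = "{{x\<in>X. d c x < ennreal r} |c r. c \<in> X} \<union> {{x\<in>X. d c x > ennreal r} |c r. c \<in> X}"
  assume lim: "x \<in> X \<and> (\<forall>c\<in>X. ((\<lambda>i. d c (x' i)) \<longlongrightarrow> d c x) F)"
  have "\<forall>\<^sub>F i in F. x' i \<in> U" if "generate_topology_on ?B U" "x \<in> U" for U
    using that
  proof (induction rule: generate_topology_on.induct)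
    case (Int a b)
    then show ?case
      by (auto intro: eventually_conj)
  next
    case (UN K)
    then obtain k where k: "k \<in> K" "x \<in> k"
      by blast
    with UN have "\<forall>\<^sub>F i in F. x' i \<in> k"
      by blast
    then show ?case
      by eventually_elim (use k in auto)
  next
    case (Basis s)
    then consider c r where "c \<in> X" "s = {y\<in>X. d c y < ennreal r}"
      | c r where "c \<in> X" "s = {y\<in>X. d c y > ennreal r}"
      by blast
    then show ?case
    proof cases
      case 1
      then have "\<forall>\<^sub>F i in F. d c (x' i) < ennreal r"
        using lim Basis by (intro order_tendstoD(2)[of _ "d c x"]) auto
      with ev show ?thesis
        by eventually_elim (use 1 in auto)
    next
      case 2
      then have "\<forall>\<^sub>F i in F. d c (x' i) > ennreal r"
        using lim Basis by (intro order_tendstoD(1)[of _ "d c x"]) auto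
      with ev show ?thesis
        by eventually_elim (use 2 in auto)
    qed
  qed auto
  then show "limitin (smyth_topology X d) x' x F"
    using lim unfolding limitin_def topspace_smyth_topology
    by (auto simp: smyth_topology_def openin_topology_generated_by_iff)
qed

section \<open>Approximation of finitely many distances at once\<close>

text \<open>Non-strict bounds on \<open>d c z\<close> allow \<open>d c x = \<infinity>\<close>, where nothing is demanded.\<close>

definition approximable :: "'a set \<Rightarrow> ('a \<Rightarrow> 'a \<Rightarrow> ennreal) \<Rightarrow> bool" where
  "approximable X d \<longleftrightarrow>
     (\<forall>F\<in>Fpow X. \<forall>x\<in>X. \<forall>e>0. \<exists>z\<in>X. d z x < ennreal e \<and> (\<forall>c\<in>F. d c z \<le> d c x + ennreal e))"

lemma approximableD:
  assumes "approximable X d" "F \<in> Fpow X" "x \<in> X" "0 < e"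
  obtains z where "z \<in> X" "d z x < ennreal e" "\<And>c. c \<in> F \<Longrightarrow> d c z \<le> d c x + ennreal e"
  using assms unfolding approximable_def by blast

lemma Phi_le_witness:
  assumes le: "rel_le W X (rel_comp_Phi X a d) a"
    and "w \<in> W" "x \<in> X" "a w x < r" "0 < e"
  obtains z where "z \<in> X" "d z x < ennreal e" "a w z < r"
proof -
  have "(INF z\<in>{z\<in>X. d z x < ennreal e}. a w z) \<le> rel_comp_Phi X a d w x"
    unfolding rel_comp_Phi_def using \<open>0 < e\<close> by (intro SUP_upper) auto
  also have "\<dots> \<le> a w x"
    using assms by (auto simp: rel_le_def)
  also note \<open>a w x < r\<close>
  finally show thesis
    using that by (auto simp: INF_less_iff)
qed

lemma fin_Phi_le_imp_Phi_le:
  assumes "rel_le (Fpow X) X (rel_comp_Phi X (fin_dist d) d) (fin_dist d)"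
  shows "rel_le X X (rel_comp_Phi X d d) d"
  unfolding rel_le_def
proof (intro ballI)
  fix c x assume "c \<in> X" "x \<in> X"
  then have "rel_comp_Phi X (fin_dist d) d {c} x \<le> fin_dist d {c} x"
    using assms by (auto simp: rel_le_def Fpow_def)
  then show "rel_comp_Phi X d d c x \<le> d c x"
    by (simp add: rel_comp_Phi_def fin_dist_def)
qed

lemma fin_Phi_le_imp_precapprox:
  assumes le: "rel_le (Fpow X) X (rel_comp_Phi X (fin_dist d) d) (fin_dist d)"
  shows "rel_precapprox (Fpow X) X (rel_comp X (fin_dist d) d) (fin_dist d)"
  unfolding rel_precapprox_def
proof (intro allI impI)
  fix Z assume Z: "Z \<subseteq> Fpow X \<times> X" and 0: "(INF (F, y)\<in>Z. fin_dist d F y) = 0"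
  have "(INF (F, y)\<in>Z. rel_comp X (fin_dist d) d F y) \<le> 0"
  proof (rule ennreal_le_epsilon)
    fix e :: real assume e: "0 < e"
    then have "(INF (F, y)\<in>Z. fin_dist d F y) < ennreal (e / 2)"
      using 0 by simp
    then obtain F y where Fy: "(F, y) \<in> Z" "fin_dist d F y < ennreal (e / 2)"
      by (auto simp: INF_less_iff)
    then obtain z where z: "z \<in> X" "d z y < ennreal (e / 2)" "fin_dist d F z < ennreal (e / 2)"
      using Phi_le_witness[OF le, of F y _ "e / 2"] Z e by auto
    have "(INF (F, y)\<in>Z. rel_comp X (fin_dist d) d F y) \<le> rel_comp X (fin_dist d) d F y"
      using Fy(1) by (intro INF_lower2[of "(F, y)"]) auto
    also have "\<dots> \<le> fin_dist d F z + d z y"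
      unfolding rel_comp_def using z(1) by (rule INF_lower)
    also have "\<dots> \<le> ennreal (e / 2) + ennreal (e / 2)"
      using z by (intro add_mono less_imp_le)
    finally show "(INF (F, y)\<in>Z. rel_comp X (fin_dist d) d F y) \<le> 0 + ennreal e"
      using e by (simp add: ennreal_half)
  qed
  then show "(INF (F, y)\<in>Z. rel_comp X (fin_dist d) d F y) = 0"
    by simp
qed

text \<open>The relation \<open>\<precapprox>\<close> is uniform: a \<open>\<delta>\<close> that depends only on \<open>e\<close> is obtained by applying the
  definition to the set of all pairs at which \<open>a\<close> is at least \<open>e\<close>.\<close>

lemma rel_precapprox_modulus:
  assumes "rel_precapprox W Y a b" "0 < e"
  obtains \<delta> :: real where "0 < \<delta>"
    "\<And>w y. w \<in> W \<Longrightarrow> y \<in> Y \<Longrightarrow> b w y < ennreal \<delta> \<Longrightarrow> a w y < ennreal e"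
proof -
  let ?Z = "{(w, y) \<in> W \<times> Y. ennreal e \<le> a w y}"
  have "ennreal e \<le> (INF (w, y)\<in>?Z. a w y)"
    by (rule INF_greatest) auto
  then have "(INF (w, y)\<in>?Z. a w y) \<noteq> 0"
    using \<open>0 < e\<close> by auto
  moreover have "?Z \<subseteq> W \<times> Y"
    by auto
  ultimately have "0 < (INF (w, y)\<in>?Z. b w y)"
    using assms(1) unfolding rel_precapprox_def zero_less_iff_neq_zero by blast
  then obtain \<delta> where \<delta>: "0 < \<delta>" "ennreal \<delta> < (INF (w, y)\<in>?Z. b w y)"
    by (rule ennreal_pos_real_below)
  show thesis
  proof (rule that[OF \<delta>(1)])
    fix w y assume wy: "w \<in> W" "y \<in> Y" "b w y < ennreal \<delta>"
    show "a w y < ennreal e"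
    proof (rule ccontr)
      assume "\<not> a w y < ennreal e"
      then have "(INF (w, y)\<in>?Z. b w y) \<le> b w y"
        using wy by (intro INF_lower2[of "(w, y)"]) auto
      then show False
        using \<delta>(2) wy(3) by (meson leD order.strict_trans)
    qed
  qed
qed

text \<open>Handling each \<open>c \<in> F\<close> individually by \<open>d \<circ> \<Phi>\<^sup>d \<le> d\<close> gives points \<open>g c\<close> within \<open>\<delta>\<close> of \<open>x\<close>. With
  \<open>\<delta>\<close> taken from the modulus of \<open>\<precapprox>\<close>, the finite set of these points has a common interpolating
  point \<open>z\<close>, and \<open>d c z \<le> d c (g c) + d (g c) z\<close>.\<close>

lemma precapprox_imp_approximable:
  assumes dist: "distance_on X d"
    and pre: "rel_precapprox (Fpow X) X (rel_comp X (fin_dist d) d) (fin_dist d)"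
    and le: "rel_le X X (rel_comp_Phi X d d) d"
  shows "approximable X d"
  unfolding approximable_def
proof (intro ballI allI impI)
  fix F x and e :: real assume F: "F \<in> Fpow X" and x: "x \<in> X" and e: "0 < e"
  obtain \<delta> where \<delta>: "0 < \<delta>" and mod: "\<And>G y. G \<in> Fpow X \<Longrightarrow> y \<in> X \<Longrightarrow>
      fin_dist d G y < ennreal \<delta> \<Longrightarrow> rel_comp X (fin_dist d) d G y < ennreal (e / 2)"
    using rel_precapprox_modulus[OF pre, of "e / 2"] e by auto
  (* Infinite distances satisfy every bound, and the strict inequality needed to choose g c is
     available only for finite ones. *)
  define F' where "F' = {c\<in>F. d c x < top}"
  have "\<exists>z\<in>X. d z x < ennreal (\<delta> / 2) \<and> d c z \<le> d c x + ennreal (e / 2)" if c: "c \<in> F'" for c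
  proof -
    have "d c x < d c x + ennreal (e / 2)"
      using e c by (auto simp: F'_def less_top)
    moreover have "c \<in> X"
      using c F by (auto simp: F'_def Fpow_def)
    ultimately obtain z where "z \<in> X" "d z x < ennreal (\<delta> / 2)" "d c z < d c x + ennreal (e / 2)"
      using Phi_le_witness[OF le _ x, of c _ "\<delta> / 2"] \<delta> half_gt_zero by metis
    then show ?thesis
      by (auto intro: less_imp_le)
  qed
  then obtain g where g: "\<And>c. c \<in> F' \<Longrightarrow> g c \<in> X \<and> d (g c) x < ennreal (\<delta> / 2) \<and>
      d c (g c) \<le> d c x + ennreal (e / 2)"
    by metis
  (* The half of delta keeps the inequality strict after passing to the supremum. *)
  have "fin_dist d (g ` F') x \<le> ennreal (\<delta> / 2)"
    unfolding fin_dist_def by (rule SUP_least) (use g in \<open>auto intro: less_imp_le\<close>)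
  also have "\<dots> < ennreal \<delta>"
    using \<delta> by (simp add: ennreal_less_iff)
  finally have "rel_comp X (fin_dist d) d (g ` F') x < ennreal (e / 2)"
    using F g x by (intro mod) (auto simp: Fpow_def F'_def)
  then obtain z where z: "z \<in> X" "fin_dist d (g ` F') z + d z x < ennreal (e / 2)"
    by (auto simp: rel_comp_def INF_less_iff)
  have "d z x \<le> fin_dist d (g ` F') z + d z x"
    by (simp add: add_increasing)
  also note z(2)
  also have "ennreal (e / 2) < ennreal e"
    using e by (simp add: ennreal_less_iff)
  finally have "d z x < ennreal e" .
  moreover have "d c z \<le> d c x + ennreal e" if c: "c \<in> F" for c
  proof (cases "d c x = top")
    case False
    with c have c': "c \<in> F'"
      by (simp add: F'_def less_top)
    have "d (g c) z \<le> fin_dist d (g ` F') z"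
      unfolding fin_dist_def using c' by (intro SUP_upper) auto
    also have "\<dots> \<le> fin_dist d (g ` F') z + d z x"
      by (simp add: add_increasing2)
    finally have gz: "d (g c) z \<le> ennreal (e / 2)"
      using z(2) by (meson less_imp_le order.trans)
    have "d c z \<le> d c (g c) + d (g c) z"
      using dist F c c' g z(1) unfolding distance_on_def Fpow_def by blast
    also have "\<dots> \<le> (d c x + ennreal (e / 2)) + ennreal (e / 2)"
      using g[OF c'] gz by (intro add_mono) auto
    finally show ?thesis
      using e by (simp add: add.assoc ennreal_half)
  qed simp
  ultimately show "\<exists>z\<in>X. d z x < ennreal e \<and> (\<forall>c\<in>F. d c z \<le> d c x + ennreal e)"
    using z(1) by blast
qed

lemma approximable_imp_fin_Phi_le:
  assumes ap: "approximable X d"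
  shows "rel_le (Fpow X) X (rel_comp_Phi X (fin_dist d) d) (fin_dist d)"
  unfolding rel_le_def rel_comp_Phi_def
proof (intro ballI SUP_least)
  fix F x and r :: real assume F: "F \<in> Fpow X" and x: "x \<in> X" and "r \<in> {0<..}"
  then have r: "0 < r"
    by simp
  show "(INF z\<in>{z\<in>X. d z x < ennreal r}. fin_dist d F z) \<le> fin_dist d F x"
  proof (rule ennreal_le_epsilon)
    fix e :: real assume e: "0 < e"
    obtain z where z: "z \<in> X" "d z x < ennreal (min e r)"
        "\<And>c. c \<in> F \<Longrightarrow> d c z \<le> d c x + ennreal (min e r)"
      using approximableD[OF ap F x, of "min e r"] e r by auto
    have "d z x < ennreal r"
      using z(2) by (rule order.strict_trans2) (auto intro: ennreal_leI)
    then have "(INF z\<in>{z\<in>X. d z x < ennreal r}. fin_dist d F z) \<le> fin_dist d F z"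
      using z(1) by (intro INF_lower) auto
    also have "\<dots> \<le> fin_dist d F x + ennreal e"
      unfolding fin_dist_def
    proof (rule SUP_least)
      fix c assume c: "c \<in> F"
      show "d c z \<le> (SUP y\<in>F. d y x) + ennreal e"
        by (rule order.trans[OF z(3)[OF c]] add_mono SUP_upper c ennreal_leI min.cobounded1)+
    qed
    finally show "(INF z\<in>{z\<in>X. d z x < ennreal r}. fin_dist d F z) \<le> fin_dist d F x + ennreal e" .
  qed
qed

text \<open>Let the net \<open>x'\<close> converge to \<open>x\<close>. By continuity of \<open>d (x' i)\<close> along the net, the Cauchy
  estimate for \<open>d (x' i) (x' j)\<close> passes to the limit in \<open>j\<close> and makes \<open>d (x' i) x\<close> small. Any late
  enough term of the net is then an approximating point.\<close>

lemma smyth_continuous_imp_approximable: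
  assumes "smyth_continuous TYPE('i) X d"
  shows "approximable X d"
  unfolding approximable_def
proof (intro ballI allI impI)
  fix F x and e :: real assume F: "F \<in> Fpow X" and x: "x \<in> X" and e: "0 < e"
  obtain I :: "'i set" and R x' where net: "net_in X I R x'" and C: "cauchy_net d I R x'"
      and lim: "limitin (smyth_topology X d) x' x (net_filter I R)"
    using assms x unfolding smyth_continuous_def by blast
  let ?N = "net_filter I R"
  have dir: "directed_index I R" and bot: "?N \<noteq> bot"
    using net net_filter_neq_bot by (auto simp: net_in_def)
  note inX = eventually_net_in[OF net]
  have tends: "((\<lambda>i. d c (x' i)) \<longlongrightarrow> d c x) ?N" if "c \<in> X" for c
    using lim limitin_smyth_topology_iff[OF inX] that by blast
  have "0 < e / 2"
    using e by simp
  from cauchy_net_eventually[OF dir C this] inX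
  have "\<forall>\<^sub>F i in ?N. d (x' i) x < ennreal e"
  proof eventually_elim
    case (elim i)
    then have "d (x' i) x \<le> ennreal (e / 2)"
      using tends bot by (intro tendsto_upperbound)
    also have "\<dots> < ennreal e"
      using e by (simp add: ennreal_less_iff)
    finally show "d (x' i) x < ennreal e" .
  qed
  moreover have "\<forall>\<^sub>F i in ?N. \<forall>c\<in>F. d c (x' i) \<le> d c x + ennreal e"
  proof (rule eventually_ball_finite)
    show "\<forall>c\<in>F. \<forall>\<^sub>F i in ?N. d c (x' i) \<le> d c x + ennreal e"
    proof
      fix c assume "c \<in> F"
      then have c: "c \<in> X"
        using F by (auto simp: Fpow_def)
      show "\<forall>\<^sub>F i in ?N. d c (x' i) \<le> d c x + ennreal e"
      proof (cases "d c x = top")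
        case False
        then have "\<forall>\<^sub>F i in ?N. d c (x' i) < d c x + ennreal e"
          using e by (intro order_tendstoD(2)[OF tends[OF c]]) (simp add: less_top)
        then show ?thesis
          by eventually_elim auto
      qed simp
    qed
  qed (use F in \<open>simp add: Fpow_def\<close>)
  ultimately have "\<forall>\<^sub>F i in ?N. x' i \<in> X \<and> d (x' i) x < ennreal e \<and>
      (\<forall>c\<in>F. d c (x' i) \<le> d c x + ennreal e)"
    using inX by eventually_elim auto
  then show "\<exists>z\<in>X. d z x < ennreal e \<and> (\<forall>c\<in>F. d c z \<le> d c x + ennreal e)"
    using eventually_happens'[OF bot] by blast
qed

section \<open>Cauchy nets with a prescribed limit of distances\<close>

text \<open>The map \<open>p\<close> assigns to each index a finite set \<open>F\<close> and a number \<open>n\<close>, and \<open>y j\<close> approximates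
  the profile \<open>f\<close> on \<open>F\<close> with error \<open>1 / (n + 1)\<close>. The relation \<open>i \<prec> j\<close> includes that \<open>y i\<close> belongs
  to the finite set of \<open>j\<close>. This makes the net Cauchy, since then \<open>d (y i) (y j)\<close> is at
  most \<open>f (y i)\<close> plus the error at \<open>j\<close>. It does not destroy directedness: the points already chosen
  can always be added to a larger finite set. The triangle inequality for \<open>f\<close> turns \<open>f (y j) \<rightarrow> 0\<close>
  into the lower bound for the limit of \<open>d c (y j)\<close>.\<close>

lemma ex_cauchy_net_with_profile:
  fixes p :: "'i \<Rightarrow> 'a set \<times> nat"
  assumes p: "p ` J = Fpow X \<times> UNIV"
    and tri: "\<And>c y. c \<in> X \<Longrightarrow> y \<in> X \<Longrightarrow> f c \<le> d c y + f y"
    and approx: "\<And>F e. F \<in> Fpow X \<Longrightarrow> 0 < e \<Longrightarrow>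
      \<exists>y\<in>X. f y \<le> ennreal e \<and> (\<forall>c\<in>F. d c y \<le> f c + ennreal e)"
  shows "\<exists>S y. net_in X J S y \<and> cauchy_net d J S y \<and>
    (\<forall>c\<in>X. ((\<lambda>j. d c (y j)) \<longlongrightarrow> f c) (net_filter J S))"
proof -
  define r where "r j = inverse (real (Suc (snd (p j))))" for j
  have r_pos: "0 < r j" for j
    by (simp add: r_def)
  have fin: "fst (p j) \<in> Fpow X" if "j \<in> J" for j
    using p that by (metis image_eqI mem_Times_iff)
  have "\<exists>y\<in>X. f y \<le> ennreal (r j) \<and> (\<forall>c\<in>fst (p j). d c y \<le> f c + ennreal (r j))" if "j \<in> J" for j
    using approx fin[OF that] r_pos by blast
  then obtain y where y: "\<And>j. j \<in> J \<Longrightarrow> y j \<in> X \<and> f (y j) \<le> ennreal (r j) \<and>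
      (\<forall>c\<in>fst (p j). d c (y j) \<le> f c + ennreal (r j))"
    by metis
  define S where "S i j \<longleftrightarrow> fst (p i) \<subseteq> fst (p j) \<and> snd (p i) < snd (p j) \<and> y i \<in> fst (p j)" for i j
  have surj: "\<exists>j\<in>J. p j = (F, n)" if "F \<in> Fpow X" for F n
    using p that by (metis (no_types, lifting) UNIV_I imageE mem_Sigma_iff)
  have dir: "directed_index J S"
    unfolding directed_index_def
  proof (intro conjI ballI)
    show "J \<noteq> {}"
      using surj[of "{}"] by (auto simp: Fpow_def)
    show "transp_on J S"
      unfolding transp_on_def S_def by (auto intro: less_trans)
    fix i j assume ij: "i \<in> J" "j \<in> J"
    have "fst (p i) \<union> fst (p j) \<union> {y i, y j} \<in> Fpow X"
      using fin[OF ij(1)] fin[OF ij(2)] y ij by (auto simp: Fpow_def)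
    then obtain k where "k \<in> J"
        "p k = (fst (p i) \<union> fst (p j) \<union> {y i, y j}, Suc (max (snd (p i)) (snd (p j))))"
      using surj
      by blast
    then show "\<exists>k\<in>J. S i k \<and> S j k"
      by (intro bexI[of _ k]) (auto simp: S_def)
  qed
  have eventually_r: "\<forall>\<^sub>F j in net_filter J S. j \<in> J \<and> F \<subseteq> fst (p j) \<and> r j \<le> e"
    if F: "F \<in> Fpow X" and e: "0 < e" for F e
  proof -
    obtain n where n: "inverse (real (Suc n)) < e"
      using reals_Archimedean[OF e] by blast
    obtain i where i: "i \<in> J" "p i = (F, n)"
      using surj[OF F] by blast
    show ?thesis
      using eventually_net_filter_after[OF dir i(1)]
    proof eventually_elim
      case (elim j)
      then have "r j \<le> inverse (real (Suc n))"
        by (auto simp: S_def i r_def intro!: le_imp_inverse_le)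
      then show ?case
        using elim n by (auto simp: S_def i)
    qed
  qed
  have net: "net_in X J S y"
    using dir y by (auto simp: net_in_def)
  have C: "cauchy_net d J S y"
    unfolding cauchy_net_iff
  proof (intro allI impI)
    fix e :: real assume e: "0 < e"
    have "\<forall>\<^sub>F i in net_filter J S. i \<in> J \<and> {} \<subseteq> fst (p i) \<and> r i \<le> e / 2"
      using e by (intro eventually_r) (auto simp: Fpow_def)
    then show "\<forall>\<^sub>F i in net_filter J S. \<forall>j\<in>J. S i j \<longrightarrow> d (y i) (y j) \<le> ennreal e"
    proof (elim eventually_mono, intro ballI impI)
      fix i j assume i: "i \<in> J \<and> {} \<subseteq> fst (p i) \<and> r i \<le> e / 2" and j: "j \<in> J" "S i j"
      have "r j \<le> r i"
        using j by (auto simp: S_def r_def intro!: le_imp_inverse_le)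
      then have rj: "ennreal (r j) \<le> ennreal (e / 2)"
        using i by (intro ennreal_leI) simp
      have "f (y i) \<le> ennreal (r i)" "ennreal (r i) \<le> ennreal (e / 2)"
        using y[of i] i by (auto intro: ennreal_leI)
      then have fi: "f (y i) \<le> ennreal (e / 2)"
        by (rule order.trans)
      have "d (y i) (y j) \<le> f (y i) + ennreal (r j)"
        using y[OF j(1)] j(2) by (auto simp: S_def)
      also have "\<dots> \<le> ennreal (e / 2) + ennreal (e / 2)"
        using fi rj by (rule add_mono)
      finally show "d (y i) (y j) \<le> ennreal e"
        using e by (simp add: ennreal_half)
    qed
  qed
  have lim: "((\<lambda>j. d c (y j)) \<longlongrightarrow> f c) (net_filter J S)" if c: "c \<in> X" for c
  proof -
    have bounds: "\<forall>\<^sub>F j in net_filter J S.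
        d c (y j) \<le> f c + ennreal e \<and> f c \<le> d c (y j) + ennreal e" if e: "0 < e" for e
    proof -
      have "\<forall>\<^sub>F j in net_filter J S. j \<in> J \<and> {c} \<subseteq> fst (p j) \<and> r j \<le> e"
        using c e by (intro eventually_r) (auto simp: Fpow_def)
      then show ?thesis
      proof (elim eventually_mono, intro conjI)
        fix j assume j: "j \<in> J \<and> {c} \<subseteq> fst (p j) \<and> r j \<le> e"
        then have re: "ennreal (r j) \<le> ennreal e"
          by (intro ennreal_leI) auto
        show "d c (y j) \<le> f c + ennreal e"
          using y[of j] j re by (meson insert_subset add_left_mono order.trans)
        show "f c \<le> d c (y j) + ennreal e"
          using tri[OF c, of "y j"] y[of j] j re by (meson insert_subset add_left_mono order.trans)
      qed
    qed
    let ?N = "net_filter J S" and ?g = "\<lambda>j. d c (y j)"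
    have bot: "?N \<noteq> bot"
      using dir by (rule net_filter_neq_bot)
    have "Limsup ?N ?g \<le> f c"
    proof (rule ennreal_le_epsilon)
      fix e :: real assume "0 < e"
      then show "Limsup ?N ?g \<le> f c + ennreal e"
        by (intro Limsup_bounded eventually_mono[OF bounds]) auto
    qed
    moreover have "f c \<le> Liminf ?N ?g"
    proof (rule ennreal_le_epsilon)
      fix e :: real assume "0 < e"
      then have "f c - ennreal e \<le> Liminf ?N ?g"
        by (intro Liminf_bounded eventually_mono[OF bounds])
          (auto simp: ennreal_minus_le_iff add.commute)
      then show "f c \<le> Liminf ?N ?g + ennreal e"
        by (simp add: ennreal_minus_le_iff add.commute)
    qed
    ultimately show ?thesis
      using Liminf_le_Limsup[OF bot, of ?g] by (intro Liminf_eq_Limsup[OF bot]) auto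
  qed
  show ?thesis
    using net C lim by blast
qed

text \<open>A code of \<open>(F, n)\<close> in the index type is obtained from the given embedding by fixing an arbitrary
  first component; this is where \<open>X\<close> has to be nonempty.\<close>

lemma ex_index_map:
  assumes emb: "X \<times> Pow X \<times> (UNIV :: nat set) \<lesssim> (UNIV :: 'i set)" and "X \<noteq> {}"
  obtains J :: "'i set" and p where "p ` J = Fpow X \<times> (UNIV :: nat set)"
proof -
  obtain h :: "_ \<Rightarrow> 'i" where h: "inj_on h (X \<times> Pow X \<times> (UNIV :: nat set))"
    using emb by (auto simp: lepoll_def)
  obtain a where a: "a \<in> X"
    using \<open>X \<noteq> {}\<close> by blast
  let ?A = "Fpow X \<times> (UNIV :: nat set)" and ?k = "\<lambda>(F, n). h (a, F, n)"
  have inj: "inj_on ?k ?A"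
    using a h by (auto simp: inj_on_def Fpow_def)
  have "inv_into ?A ?k ` (?k ` ?A) = ?A"
    using inj by (rule inv_into_image_cancel) simp
  then show thesis
    by (rule that)
qed

section \<open>Smyth continuity and replacement of nets\<close>

lemma approximable_imp_smyth_continuous:
  assumes dist: "distance_on X d"
    and emb: "X \<times> Pow X \<times> (UNIV :: nat set) \<lesssim> (UNIV :: 'i set)"
    and ap: "approximable X d"
  shows "smyth_continuous TYPE('i) X d"
  unfolding smyth_continuous_def
proof
  fix x assume x: "x \<in> X"
  then have "X \<noteq> {}"
    by blast
  then obtain J :: "'i set" and p where p: "p ` J = Fpow X \<times> (UNIV :: nat set)"
    by (rule ex_index_map[OF emb])
  have tri: "d c x \<le> d c y + d y x" if "c \<in> X" "y \<in> X" for c y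
    using dist x that by (auto simp: distance_on_def)
  have approx: "\<exists>y\<in>X. d y x \<le> ennreal e \<and> (\<forall>c\<in>F. d c y \<le> d c x + ennreal e)"
    if "F \<in> Fpow X" "0 < e" for F e
    using approximableD[OF ap that(1) x that(2)] by (metis less_imp_le)
  obtain S y where y: "net_in X J S y" "cauchy_net d J S y"
      "\<And>c. c \<in> X \<Longrightarrow> ((\<lambda>j. d c (y j)) \<longlongrightarrow> d c x) (net_filter J S)"
    using ex_cauchy_net_with_profile[OF p tri approx] by blast
  then show "\<exists>(I :: 'i set) R x'. net_in X I R x' \<and> cauchy_net d I R x' \<and>
      limitin (smyth_topology X d) x' x (net_filter I R)"
    using limitin_smyth_topology_iff[OF eventually_net_in[OF y(1)]] x by blast
qed

text \<open>The profile is \<open>f = dist_net d I R x\<close>. To approximate it on \<open>F\<close>, choose a late term \<open>a\<close> of the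
  given net, for which \<open>d c a\<close> is at most slightly above \<open>f c\<close> on \<open>F\<close> and \<open>f\<close> at most slightly above
  \<open>d c a\<close> on \<open>X\<close>, and then a point \<open>y\<close> approximating \<open>a\<close>. In general \<open>a\<close> itself will not do, because
  \<open>f a\<close> need not be small: self-distances may be positive.\<close>

lemma lower_cauchy_net_replacement:
  assumes dist: "distance_on X d"
    and emb: "X \<times> Pow X \<times> (UNIV :: nat set) \<lesssim> (UNIV :: 'i set)"
    and ap: "approximable X d"
    and net: "net_in X I R x" and C: "cauchy_net (lower_hemimetric X d) I R x"
  obtains J :: "'i set" and S y where "net_in X J S y" "cauchy_net d J S y"
    "\<And>z. net_dist (lower_hemimetric X d) I R x z = net_dist (lower_hemimetric X d) J S y z"
    "\<And>z. z \<in> X \<Longrightarrow> dist_net d I R x z = dist_net d J S y z"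
proof -
  let ?N = "net_filter I R"
  define f where "f = dist_net d I R x"
  have dir: "directed_index I R" and bot: "?N \<noteq> bot"
    using net net_filter_neq_bot by (auto simp: net_in_def)
  note inX = eventually_net_in[OF net]
  have tends: "((\<lambda>\<mu>. d c (x \<mu>)) \<longlongrightarrow> f c) ?N" if "c \<in> X" for c
    unfolding f_def using dir C that by (rule lower_cauchy_tendsto_dist_net)
  have "X \<noteq> {}"
    using eventually_happens'[OF bot inX] by blast
  then obtain J :: "'i set" and p where p: "p ` J = Fpow X \<times> (UNIV :: nat set)"
    by (rule ex_index_map[OF emb])
  have tri: "f c \<le> d c y + f y" if "c \<in> X" "y \<in> X" for c y
  proof (rule tendsto_le[OF bot _ tends[OF that(1)]])
    show "((\<lambda>\<mu>. d c y + d y (x \<mu>)) \<longlongrightarrow> d c y + f y) ?N"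
      using tends[OF that(2)] by (intro tendsto_add tendsto_const)
    show "\<forall>\<^sub>F \<mu> in ?N. d c (x \<mu>) \<le> d c y + d y (x \<mu>)"
      using inX by eventually_elim (use dist that in \<open>auto simp: distance_on_def\<close>)
  qed
  have approx: "\<exists>y\<in>X. f y \<le> ennreal e \<and> (\<forall>c\<in>F. d c y \<le> f c + ennreal e)"
    if F: "F \<in> Fpow X" and e: "0 < e" for F e
  proof -
    have "\<forall>\<^sub>F \<gamma> in ?N. \<forall>c\<in>F. d c (x \<gamma>) \<le> f c + ennreal (e / 2)"
    proof (rule eventually_ball_finite)
      show "\<forall>c\<in>F. \<forall>\<^sub>F \<gamma> in ?N. d c (x \<gamma>) \<le> f c + ennreal (e / 2)"
      proof
        fix c assume "c \<in> F"
        then have c: "c \<in> X"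
          using F by (auto simp: Fpow_def)
        show "\<forall>\<^sub>F \<gamma> in ?N. d c (x \<gamma>) \<le> f c + ennreal (e / 2)"
        proof (cases "f c = top")
          case False
          then have "\<forall>\<^sub>F \<gamma> in ?N. d c (x \<gamma>) < f c + ennreal (e / 2)"
            using e by (intro order_tendstoD(2)[OF tends[OF c]]) (simp add: less_top)
          then show ?thesis
            by eventually_elim auto
        qed simp
      qed
    qed (use F in \<open>simp add: Fpow_def\<close>)
    moreover have "\<forall>\<^sub>F \<gamma> in ?N. \<forall>c\<in>X. f c \<le> d c (x \<gamma>) + ennreal (e / 2)"
      unfolding f_def using lower_cauchy_dist_net_le[OF dir C] e by simp
    ultimately have "\<forall>\<^sub>F \<gamma> in ?N. x \<gamma> \<in> X \<and> (\<forall>c\<in>F. d c (x \<gamma>) \<le> f c + ennreal (e / 2)) \<and>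
        (\<forall>c\<in>X. f c \<le> d c (x \<gamma>) + ennreal (e / 2))"
      using inX by eventually_elim auto
    then obtain a where a: "a \<in> X" "\<And>c. c \<in> F \<Longrightarrow> d c a \<le> f c + ennreal (e / 2)"
        "\<And>c. c \<in> X \<Longrightarrow> f c \<le> d c a + ennreal (e / 2)"
      using eventually_happens'[OF bot] by blast
    obtain y where y: "y \<in> X" "d y a < ennreal (e / 2)"
        "\<And>c. c \<in> F \<Longrightarrow> d c y \<le> d c a + ennreal (e / 2)"
      using approximableD[OF ap F a(1), of "e / 2"] e by auto
    have "f y \<le> d y a + ennreal (e / 2)"
      using a(3) y(1) .
    also have "\<dots> \<le> ennreal (e / 2) + ennreal (e / 2)"
      using y(2) by (intro add_right_mono less_imp_le)
    finally have "f y \<le> ennreal e"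
      using e by (simp add: ennreal_half)
    moreover have "d c y \<le> f c + ennreal e" if "c \<in> F" for c
    proof -
      have "d c y \<le> (f c + ennreal (e / 2)) + ennreal (e / 2)"
        using y(3)[OF that] a(2)[OF that] by (meson add_right_mono order.trans)
      then show ?thesis
        using e by (simp add: add.assoc ennreal_half)
    qed
    ultimately show ?thesis
      using y(1) by blast
  qed
  obtain S y where y: "net_in X J S y" "cauchy_net d J S y"
      "\<And>c. c \<in> X \<Longrightarrow> ((\<lambda>j. d c (y j)) \<longlongrightarrow> f c) (net_filter J S)"
    using ex_cauchy_net_with_profile[OF p tri approx] by blast
  have dirJ: "directed_index J S"
    using y(1) by (simp add: net_in_def)
  have eq: "dist_net d I R x c = dist_net d J S y c" if "c \<in> X" for c
    using lim_imp_Liminf[OF net_filter_neq_bot[OF dirJ] y(3)[OF that]]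
    by (simp add: dist_net_def f_def)
  have "net_dist (lower_hemimetric X d) I R x z = net_dist (lower_hemimetric X d) J S y z" for z
    unfolding lower_cauchy_net_dist_eq[OF dir C]
      lower_cauchy_net_dist_eq[OF dirJ cauchy_net_lower_hemimetric[OF dist y(1,2)]]
    by (intro SUP_cong) (simp_all add: eq)
  then show thesis
    using that[OF y(1,2)] eq by blast
qed

lemma constant_net:
  assumes "x \<in> X"
  shows "net_in X {i} (\<lambda>_ _. True) (\<lambda>_. x)"
    and "cauchy_net (lower_hemimetric X d) {i} (\<lambda>_ _. True) (\<lambda>_. x)"
    and "dist_net d {i} (\<lambda>_ _. True) (\<lambda>_. x) c = d c x"
proof -
  have dir: "directed_index {i} (\<lambda>_ _. True)"
    by (auto simp: directed_index_def transp_on_def)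
  show "net_in X {i} (\<lambda>_ _. True) (\<lambda>_. x)"
    using dir assms by (simp add: net_in_def)
  show "cauchy_net (lower_hemimetric X d) {i} (\<lambda>_ _. True) (\<lambda>_. x)"
    by (simp add: cauchy_net_iff lower_hemimetric_le_iff add_increasing2)
  show "dist_net d {i} (\<lambda>_ _. True) (\<lambda>_. x) c = d c x"
    unfolding dist_net_def using net_filter_neq_bot[OF dir] by (rule Liminf_const)
qed

text \<open>A \<open>d\<close>-Cauchy net is Cauchy for the lower hemimetric, so that the limit inferior in
  \<open>dist_net\<close> is a limit; agreement with \<open>x\<close> in this one function already means convergence.\<close>

lemma cauchy_dist_net_imp_limitin:
  assumes dist: "distance_on X d" and y: "net_in X J S y" "cauchy_net d J S y"
    and x: "x \<in> X" and eq: "\<And>c. c \<in> X \<Longrightarrow> d c x = dist_net d J S y c"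
  shows "limitin (smyth_topology X d) y x (net_filter J S)"
proof -
  have dirJ: "directed_index J S"
    using y(1) by (simp add: net_in_def)
  show ?thesis
    using lower_cauchy_tendsto_dist_net[OF dirJ cauchy_net_lower_hemimetric[OF dist y]] x eq
    by (simp add: limitin_smyth_topology_iff[OF eventually_net_in[OF y(1)]])
qed

theorem theorem2p2:
  fixes X :: "'a set" and d :: "'a \<Rightarrow> 'a \<Rightarrow> ennreal"
  assumes dist: "distance_on X d"
    and index_type: "X \<times> Pow X \<times> (UNIV :: nat set) \<lesssim> (UNIV :: 'i set)"
  shows "(smyth_continuous TYPE('i) X d \<longleftrightarrow>
            rel_le (Fpow X) X (rel_comp_Phi X (fin_dist d) d) (fin_dist d)) \<and>
         (rel_le (Fpow X) X (rel_comp_Phi X (fin_dist d) d) (fin_dist d) \<longleftrightarrow>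
            rel_precapprox (Fpow X) X (rel_comp X (fin_dist d) d) (fin_dist d) \<and>
            rel_le X X (rel_comp_Phi X d d) d) \<and>
         (rel_le (Fpow X) X (rel_comp_Phi X (fin_dist d) d) (fin_dist d) \<longleftrightarrow>
            (\<forall>(I :: 'j set) R x.
               net_in X I R x \<and> cauchy_net (lower_hemimetric X d) I R x \<longrightarrow>
               (\<exists>(J :: 'i set) S y. net_in X J S y \<and> cauchy_net d J S y \<and>
                  (\<forall>z\<in>X. net_dist (lower_hemimetric X d) I R x z
                         = net_dist (lower_hemimetric X d) J S y z) \<and>
                  (\<forall>z\<in>X. dist_net d I R x z = dist_net d J S y z))))"
    (is "(?one \<longleftrightarrow> ?two) \<and> (?two \<longleftrightarrow> ?three) \<and> (?two \<longleftrightarrow> ?four)")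
proof -
  have two: "?two \<longleftrightarrow> approximable X d" and three: "?three \<longleftrightarrow> approximable X d"
    using fin_Phi_le_imp_Phi_le fin_Phi_le_imp_precapprox precapprox_imp_approximable[OF dist]
      approximable_imp_fin_Phi_le by blast+
  have one: "?one \<longleftrightarrow> approximable X d"
    using smyth_continuous_imp_approximable approximable_imp_smyth_continuous[OF dist index_type]
    by blast
  have four: ?four if "approximable X d"
    using lower_cauchy_net_replacement[OF dist index_type that] by (metis (no_types, lifting))
  have ?one if 4: ?four
    unfolding smyth_continuous_def
  proof
    fix x assume x: "x \<in> X"
    (* Any element of the index type carries the constant net at x. *)
    fix i :: 'j
    obtain J :: "'i set" and S y where y: "net_in X J S y" "cauchy_net d J S y"
        and eq: "\<forall>c\<in>X. dist_net d {i} (\<lambda>_ _. True) (\<lambda>_. x) c = dist_net d J S y c"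
      using 4[rule_format, OF conjI, OF constant_net(1)[OF x, of i] constant_net(2)[OF x, of d i]]
      by blast
    have "d c x = dist_net d J S y c" if "c \<in> X" for c
      using eq constant_net(3)[OF x, of d i c] that by metis
    then have "limitin (smyth_topology X d) y x (net_filter J S)"
      using cauchy_dist_net_imp_limitin[OF dist y x] by blast
    with y show "\<exists>(I :: 'i set) R x'. net_in X I R x' \<and> cauchy_net d I R x' \<and>
        limitin (smyth_topology X d) x' x (net_filter I R)"
      by blast
  qed
  with one two three four show ?thesis
    by blast
qed

end
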